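(* Let $H$ be one of the following graphs, where $C_{2k+1}$ with $k\ge 2$ denotes an odd hole (chordless cycle on $2k+1$ nodes): (i) an odd hole $C_{2k+1}$ together with one additional edge parallel to an edge of the hole; (ii) an odd hole $C_{2k+1}$ together with one chord; (iii) an odd hole $C_{2k+1}$ together with one path of odd length whose endnodes are two non-adjacent nodes of the hole and whose internal nodes are new (not in the hole). Then the line graph $L(H)$ is $N_+$-imperfect.
   Context: The line graph $L(H)$ of a graph $H$ (parallel edges allowed) has the edges of $H$ as nodes, two being adjacent iff the edges share an endnode. For a graph $G=(V,E)$ with $V=\{1,\dots,n\}$, let ${\rm ESTAB}(G)=\{x\in\mathbb{R}^n_+ : x_i+x_j\le 1 \ \forall ij\in E\}$ and ${\rm STAB}(G)$ the convex hull of incidence vectors of stable sets of $G$. For a convex set $K\subseteq[0,1]^n$, let $\mathrm{cone}(K)=\{(x_0,x)\in\mathbb{R}^{n+1}: x=x_0y,\ y\in K\}$, and let $M_+(K)$ be the set of symmetric positive semidefinite $(n+1)\times(n+1)$ matrices $Y$ (indices $0,\dots,n$) with $Ye_0=\mathrm{diag}(Y)$, $Ye_i\in\mathrm{cone}(K)$ and $Y(e_0-e_i)\in\mathrm{cone}(K)$ for $i=1,\dots,n$. Then $N_+(K)=\{x\in[0,1]^n : (1,x)^T=Ye_0 \text{ for some } Y\in M_+(K)\}$. Write $N_+(G)=N_+({\rm ESTAB}(G))$. A graph $G$ is $N_+$-perfect if $N_+(G)={\rm STAB}(G)$, and $N_+$-imperfect otherwise. *)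

theory Defs
  imports "HOL-Analysis.Analysis"
begin

text \<open>
  A loopless undirected multigraph. Its edge set is the whole type \<^typ>\<open>'e\<close>, so that
  \<^typ>\<open>real ^ 'e\<close> is the space of vectors indexed by the edges; distinct edges may have
  the same endnodes.
\<close>

record ('v, 'e) multigraph =
  nodes :: "'v set"
  ends :: "'e \<Rightarrow> 'v set"

text \<open>
  A simple graph whose node set is the whole type \<^typ>\<open>'n\<close> is represented by its set of
  edges, each of them a two-element set.
\<close>

definition line_graph :: "('v, 'e) multigraph \<Rightarrow> 'e set set" where
  "line_graph H = {{e, f} | e f. e \<noteq> f \<and> ends H e \<inter> ends H f \<noteq> {}}"

lemma card_edge_line_graph: "X \<in> line_graph H \<Longrightarrow> card X = 2"
  by (auto simp: line_graph_def)


definition ESTAB :: "'n::finite set set \<Rightarrow> (real ^ 'n) set" where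
  "ESTAB E = {x. (\<forall>i. 0 \<le> x $ i) \<and> (\<forall>i j. {i, j} \<in> E \<longrightarrow> x $ i + x $ j \<le> 1)}"

definition stable :: "'n set set \<Rightarrow> 'n set \<Rightarrow> bool" where
  "stable E S \<longleftrightarrow> (\<forall>i\<in>S. \<forall>j\<in>S. {i, j} \<notin> E)"

definition incidence_vector :: "'n::finite set \<Rightarrow> real ^ 'n" where
  "incidence_vector S = (\<chi> i. indicator S i)"

definition STAB :: "'n::finite set set \<Rightarrow> (real ^ 'n) set" where
  "STAB E = convex hull (incidence_vector ` {S. stable E S})"

text \<open>
  The indices $0, 1, \dots, n$ are the elements of \<^typ>\<open>'n option\<close>, with \<^const>\<open>None\<close>
  for $0$ and \<^term>\<open>Some i\<close> for $i$.
\<close>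

definition homogenize :: "real \<Rightarrow> real ^ 'n \<Rightarrow> real ^ ('n::finite option)" where
  "homogenize x0 x = (\<chi> j. case j of None \<Rightarrow> x0 | Some i \<Rightarrow> x $ i)"

text \<open>
  No sign condition on \<^term>\<open>x0\<close> is imposed. In \<open>M_plus\<close> below it would be redundant:
  \<open>Y *v e\<close> has the \<^const>\<open>None\<close>-entry \<^term>\<open>e \<bullet> (Y *v e)\<close> both for the unit vectors
  $e = e_i$ and for $e = e_0 - e_i$, because $Y e_0 = \mathrm{diag}(Y)$ and $Y$ is symmetric.
\<close>

definition cone_of :: "(real ^ 'n::finite) set \<Rightarrow> (real ^ ('n option)) set" where
  "cone_of K = {homogenize x0 x | x0 x. \<exists>y\<in>K. x = x0 *\<^sub>R y}"

definition pos_semidef :: "real ^ 'm ^ 'm::finite \<Rightarrow> bool" where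
  "pos_semidef Y \<longleftrightarrow> transpose Y = Y \<and> (\<forall>z. 0 \<le> z \<bullet> (Y *v z))"

definition M_plus :: "(real ^ 'n::finite) set \<Rightarrow> (real ^ ('n option) ^ ('n option)) set" where
  "M_plus K = {Y. pos_semidef Y \<and>
     Y *v axis None 1 = (\<chi> j. Y $ j $ j) \<and>
     (\<forall>i. Y *v axis (Some i) 1 \<in> cone_of K \<and>
          Y *v (axis None 1 - axis (Some i) 1) \<in> cone_of K)}"

definition N_plus :: "(real ^ 'n::finite) set \<Rightarrow> (real ^ 'n) set" where
  "N_plus K = {x. (\<forall>i. 0 \<le> x $ i \<and> x $ i \<le> 1) \<and>
     (\<exists>Y\<in>M_plus K. homogenize 1 x = Y *v axis None 1)}"

definition N_plus_perfect :: "'n::finite set set \<Rightarrow> bool" where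
  "N_plus_perfect E \<longleftrightarrow> N_plus (ESTAB E) = STAB E"

abbreviation N_plus_imperfect :: "'n::finite set set \<Rightarrow> bool" where
  "N_plus_imperfect E \<equiv> \<not> N_plus_perfect E"


text \<open>
  The nodes \<open>W\<close> and the edges \<open>C\<close> form a cycle on \<open>n\<close> nodes. Since \<open>C\<close> contains the edges
  of the cycle and nothing else, \<open>(W, C)\<close> is a chordless cycle; further edges of \<open>H\<close> between
  nodes of \<open>W\<close> are not excluded.
\<close>

definition is_cycle :: "('v, 'e) multigraph \<Rightarrow> nat \<Rightarrow> 'v set \<Rightarrow> 'e set \<Rightarrow> bool" where
  "is_cycle H n W C \<longleftrightarrow> n \<ge> 3 \<and>
     (\<exists>v e. bij_betw v {..<n} W \<and> bij_betw e {..<n} C \<and>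
        (\<forall>i<n. ends H (e i) = {v i, v (Suc i mod n)}))"

definition nonadjacent_in :: "('v, 'e) multigraph \<Rightarrow> 'e set \<Rightarrow> 'v \<Rightarrow> 'v \<Rightarrow> bool" where
  "nonadjacent_in H C u w \<longleftrightarrow> u \<noteq> w \<and> (\<forall>e\<in>C. ends H e \<noteq> {u, w})"

text \<open>The edges \<open>P\<close> form a path with the \<open>l + 1\<close> distinct nodes \<open>p 0, \<dots>, p l\<close>, in this order.\<close>

definition is_path :: "('v, 'e) multigraph \<Rightarrow> nat \<Rightarrow> (nat \<Rightarrow> 'v) \<Rightarrow> 'e set \<Rightarrow> bool" where
  "is_path H l p P \<longleftrightarrow> inj_on p {..l} \<and>
     (\<exists>e. bij_betw e {..<l} P \<and> (\<forall>i<l. ends H (e i) = {p i, p (Suc i)}))"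

definition cycle_plus_parallel_edge :: "nat \<Rightarrow> ('v, 'e) multigraph \<Rightarrow> bool" where
  "cycle_plus_parallel_edge n H \<longleftrightarrow>
     (\<exists>f. is_cycle H n (nodes H) (- {f}) \<and> (\<exists>e. e \<noteq> f \<and> ends H f = ends H e))"

definition cycle_plus_chord :: "nat \<Rightarrow> ('v, 'e) multigraph \<Rightarrow> bool" where
  "cycle_plus_chord n H \<longleftrightarrow>
     (\<exists>f u w. is_cycle H n (nodes H) (- {f}) \<and> u \<in> nodes H \<and> w \<in> nodes H \<and>
        nonadjacent_in H (- {f}) u w \<and> ends H f = {u, w})"

definition cycle_plus_odd_path :: "nat \<Rightarrow> ('v, 'e) multigraph \<Rightarrow> bool" where
  "cycle_plus_odd_path n H \<longleftrightarrow>
     (\<exists>W C l p. is_cycle H n W C \<and> odd l \<and> is_path H l p (- C) \<and>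
        p 0 \<in> W \<and> p l \<in> W \<and> nonadjacent_in H C (p 0) (p l) \<and>
        p ` {0<..<l} \<inter> W = {} \<and> nodes H = W \<union> p ` {..l})"

end

theory Submission
  imports Defs "HOL-Number_Theory.Cong"
begin

text \<open>
  In all three cases $H$ is an odd cycle with an odd ear, so it has an odd number of nodes and a
  matching contains at most $(\vert V(H) \vert - 1) / 2$ edges. A point of $N_+$ that violates this
  rank inequality comes from Gram vectors $u_0, u_i$ with respect to a positive semidefinite form,
  where $Y_{ij} = B(u_i, u_j)$. Replacing an edge $e$ of $H$ by a path $e_1 e_2 e_3$ extends such a
  system by $u_{e_1} = u_{e_3} = u_e$ and $u_{e_2} = u_0 - u_e$, which raises both sides of the rank
  inequality by one. Thus only two line graphs on six nodes remain, those of a 5-cycle with a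
  parallel edge and of a 5-cycle with a chord; for them explicit vectors are given.
\<close>

section \<open>Gram representations of points of $N_+$\<close>

text \<open>A general form instead of an inner product: a diagonal form with rational weights then
  serves without square roots.\<close>

definition psd_form :: "('a::real_vector \<Rightarrow> 'a \<Rightarrow> real) \<Rightarrow> bool" where
  "psd_form B \<longleftrightarrow> bilinear B \<and> (\<forall>x y. B x y = B y x) \<and> (\<forall>x. 0 \<le> B x x)"

text \<open>For \<open>v\<close> equal to \<open>u i\<close> or \<open>u0 - u i\<close> this is
  membership of $Y e_i$ or $Y(e_0 - e_i)$ in the cone over ESTAB, with a strictly positive $0$-entry
  so that the column can be normalised. The upper bound on \<open>B v (u j)\<close> keeps the
  entries nonnegative when \<open>u j\<close> is replaced by \<open>u0 - u j\<close>.\<close>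

definition column_ok ::
    "('a::real_vector \<Rightarrow> 'a \<Rightarrow> real) \<Rightarrow> 'a \<Rightarrow> ('i \<Rightarrow> 'a) \<Rightarrow> 'i set set \<Rightarrow> 'a \<Rightarrow> bool" where
  "column_ok B u0 u E v \<longleftrightarrow> 0 < B v u0 \<and> (\<forall>j. 0 \<le> B v (u j) \<and> B v (u j) \<le> B v u0) \<and>
     (\<forall>j k. {j, k} \<in> E \<longrightarrow> B v (u j) + B v (u k) \<le> B v u0)"

definition N_plus_repr ::
    "('a::real_vector \<Rightarrow> 'a \<Rightarrow> real) \<Rightarrow> 'a \<Rightarrow> ('i \<Rightarrow> 'a) \<Rightarrow> 'i set set \<Rightarrow> bool" where
  "N_plus_repr B u0 u E \<longleftrightarrow> psd_form B \<and> B u0 u0 = 1 \<and>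
     (\<forall>i. B (u i) (u0 - u i) = 0 \<and> column_ok B u0 u E (u i) \<and> column_ok B u0 u E (u0 - u i))"

lemma column_ok_in_cone:
  fixes u :: "'n::finite \<Rightarrow> 'a::real_vector"
  assumes ok: "column_ok B u0 u E v" and sym: "\<And>x y. B x y = B y x"
  shows "(\<chi> j. B (case_option u0 u j) v) \<in> cone_of (ESTAB E)"
proof -
  define y :: "real ^ 'n" where "y = (\<chi> j. B v (u j) / B v u0)"
  have pos: "0 < B v u0" using ok by (simp add: column_ok_def)
  have "y \<in> ESTAB E"
    using ok pos by (auto simp: y_def ESTAB_def column_ok_def simp flip: add_divide_distrib)
  moreover have "(\<chi> j. B (case_option u0 u j) v) = homogenize (B v u0) (B v u0 *\<^sub>R y)"
    using pos by (auto simp: homogenize_def y_def vec_eq_iff sym[of _ v] split: option.split)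
  ultimately show ?thesis by (auto simp: cone_of_def)
qed

text \<open>The Gram matrix of \<open>u0\<close> and the \<open>u i\<close> belongs to
  \<open>M_plus\<close>: its quadratic form at \<open>z\<close> is \<open>B\<close> evaluated twice
  at the combination of the vectors with coefficients \<open>z\<close>, so it is positive
  semidefinite.\<close>

lemma N_plus_repr_in_N_plus:
  fixes u :: "'n::finite \<Rightarrow> 'a::real_vector"
  assumes "N_plus_repr B u0 u E"
  shows "(\<chi> i. B u0 (u i)) \<in> N_plus (ESTAB E)"
proof -
  define w where "w = case_option u0 u"
  define Y :: "real ^ 'n option ^ 'n option" where "Y = (\<chi> j k. B (w j) (w k))"
  have bil: "bilinear B" and sym: "\<And>x y. B x y = B y x" and psd: "\<And>x. 0 \<le> B x x"
    using assms by (auto simp: N_plus_repr_def psd_form_def)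
  have one: "B u0 u0 = 1" and diag: "\<And>i. B (u i) u0 = B (u i) (u i)"
    and col: "\<And>i. column_ok B u0 u E (u i)" "\<And>i. column_ok B u0 u E (u0 - u i)"
    using assms by (auto simp: N_plus_repr_def bilinear_rsub[OF bil])
  have ax: "Y *v axis k 1 = (\<chi> j. B (w j) (w k))" for k
    by (simp add: matrix_vector_mult_basis column_def Y_def)
  have "z \<bullet> (Y *v z) = B (\<Sum>j\<in>UNIV. z $ j *\<^sub>R w j) (\<Sum>j\<in>UNIV. z $ j *\<^sub>R w j)" for z
    by (simp add: bilinear_sum[OF bil] bilinear_lmul[OF bil] bilinear_rmul[OF bil] inner_vec_def
        matrix_vector_mult_def Y_def sum_distrib_left sum.cartesian_product mult_ac
        flip: UNIV_Times_UNIV)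
  then have "pos_semidef Y"
    using psd sym by (auto simp: pos_semidef_def transpose_def Y_def)
  moreover have "Y *v axis None 1 = (\<chi> j. Y $ j $ j)"
    unfolding ax by (auto simp: vec_eq_iff Y_def w_def diag one split: option.split)
  moreover have "Y *v axis (Some i) 1 \<in> cone_of (ESTAB E)" for i
    using column_ok_in_cone[OF col(1) sym, of i] unfolding ax by (simp add: w_def)
  moreover have "Y *v (axis None 1 - axis (Some i) 1) \<in> cone_of (ESTAB E)" for i
  proof -
    have "Y *v (axis None 1 - axis (Some i) 1) = (\<chi> j. B (w j) (u0 - u i))"
      unfolding matrix_vector_mult_diff_distrib ax
      by (simp add: vec_eq_iff bilinear_rsub[OF bil] w_def)
    then show ?thesis
      using column_ok_in_cone[OF col(2) sym, of i] by (simp add: w_def)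
  qed
  ultimately have "Y \<in> M_plus (ESTAB E)" by (simp add: M_plus_def)
  moreover have "homogenize 1 (\<chi> i. B u0 (u i)) = Y *v axis None 1"
    unfolding ax
    by (auto simp: vec_eq_iff homogenize_def w_def one sym[of u0 "u _"] split: option.split)
  \<comment> \<open>Both bounds come from the positive $0$-entries of the columns for
    \<open>u i\<close> and \<open>u0 - u i\<close>.\<close>
  moreover have "0 \<le> B u0 (u i) \<and> B u0 (u i) \<le> 1" for i
    using col[of i] one
    by (auto simp: column_ok_def sym[of u0 "u i"] bilinear_lsub[OF bil])
  ultimately show ?thesis by (auto simp: N_plus_def)
qed

text \<open>Complementing a vector only swaps its two column conditions. If \<open>f\<close> and
  \<open>h\<close> receive complementary vectors, the entries add up to exactly
  \<open>B v u0\<close>, so the new edge inequality holds with equality; all other edges are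
  inherited from \<open>E\<close>.\<close>

lemma N_plus_repr_lift:
  fixes u :: "'i \<Rightarrow> 'a::real_vector" and g :: "'e \<Rightarrow> 'i"
  assumes rep: "N_plus_repr B u0 u E"
    and adj: "\<And>f h. {f, h} \<in> E' \<Longrightarrow>
      s f \<and> s h \<and> {g f, g h} \<in> E \<or> g f = g h \<and> s f \<noteq> s h"
  shows "N_plus_repr B u0 (\<lambda>f. if s f then u (g f) else u0 - u (g f)) E'"
    (is "N_plus_repr B u0 ?u E'")
proof -
  have bil: "bilinear B" and sym: "\<And>x y. B x y = B y x"
    using rep by (auto simp: N_plus_repr_def psd_form_def)
  have ok: "column_ok B u0 ?u E' v" if "column_ok B u0 u E v" for v
    using that unfolding column_ok_def
    by (auto simp: bilinear_rsub[OF bil] dest!: adj)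
  have "B (?u f) (u0 - ?u f) = 0" for f
    using rep by (auto simp: N_plus_repr_def sym[of "u0 - u (g f)"])
  then show ?thesis
    using rep unfolding N_plus_repr_def by (auto intro!: ok)
qed


section \<open>The rank inequality for line graphs\<close>

lemma STAB_sum_le:
  fixes x :: "real ^ 'n::finite"
  assumes "x \<in> STAB E" and "\<And>S. stable E S \<Longrightarrow> real (card S) \<le> c"
  shows "(\<Sum>i\<in>UNIV. x $ i) \<le> c"
proof -
  have "convex {x :: real ^ 'n. (\<Sum>i\<in>UNIV. x $ i) \<le> c}"
    unfolding convex_alt
    by (auto simp: sum.distrib sum_distrib_left[symmetric] intro!: convex_bound_le)
  moreover have "incidence_vector ` {S. stable E S} \<subseteq> {x. (\<Sum>i\<in>UNIV. x $ i) \<le> c}"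
    using assms(2) by (auto simp: incidence_vector_def indicator_def sum.If_cases)
  ultimately have "STAB E \<subseteq> {x. (\<Sum>i\<in>UNIV. x $ i) \<le> c}"
    unfolding STAB_def by (rule hull_minimal[rotated])
  then show ?thesis using assms(1) by blast
qed

text \<open>A stable set of the line graph is a matching, so its edges cover disjoint pairs of
  nodes.\<close>

lemma stable_line_graph_card_le:
  fixes H :: "('v, 'e::finite) multigraph"
  assumes "stable (line_graph H) S" and "finite N"
    and N: "\<And>f. ends H f \<subseteq> N" "\<And>f. card (ends H f) = 2"
  shows "2 * card S \<le> card N"
proof -
  have "ends H f \<inter> ends H h = {}" if "f \<in> S" "h \<in> S" "f \<noteq> h" for f h
    using assms(1) that unfolding stable_def line_graph_def by blast
  moreover have "finite (ends H f)" for f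
    using N(2)[of f] card.infinite by fastforce
  ultimately have "card (\<Union>f\<in>S. ends H f) = (\<Sum>f\<in>S. card (ends H f))"
    by (intro card_UN_disjoint) auto
  also have "\<dots> = 2 * card S" by (simp add: N)
  finally show ?thesis
    using card_mono[OF \<open>finite N\<close>, of "\<Union>f\<in>S. ends H f"] N(1) by auto
qed


section \<open>Subdividing two edges of the 5-cycle\<close>

lemma sum_alternating:
  fixes a :: real
  shows "(\<Sum>j<2 * (m::nat) + 1. if even j then a else 1 - a) = a + m"
  by (induction m) auto

text \<open>
  The edges of the odd cycle, numbered along it, are mapped to the 5-cycle $0, \dots, 4$ so that the
  first $2c + 1$ of them subdivide the edge $0$ and those from $2c + 4$ on subdivide the edge $4$;
  \<open>up\<close> tells the edges with $x_f = x_e$ from those with $x_f = 1 - x_e$.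
\<close>

definition rim :: "nat \<Rightarrow> nat \<Rightarrow> nat" where
  "rim c i = min 4 (i - 2 * c)"

definition up :: "nat \<Rightarrow> nat \<Rightarrow> bool" where
  "up c i \<longleftrightarrow> even i \<or> i = 2 * c + 1 \<or> i = 2 * c + 3"

text \<open>This is the adjacency hypothesis of \<open>N_plus_repr_lift\<close> along the cycle.
  Inside a subdivided edge the image stays the same and \<open>up\<close> alternates; at the five
  junctions both edges are \<open>up\<close> and their images are consecutive on the 5-cycle.
  Truncated subtraction in \<open>rim\<close> sends all \<open>i < 2 * c\<close> to $0$.\<close>

lemma rim_up_Suc_mod:
  assumes "i < n" and n: "n = 2 * c + 2 * d + 5"
    and E: "{0, 1} \<in> E" "{1, 2} \<in> E" "{2, 3} \<in> E" "{3, 4} \<in> E" "{4, 0} \<in> E"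
  shows "up c i \<and> up c (Suc i mod n) \<and> {rim c i, rim c (Suc i mod n)} \<in> E \<or>
    rim c i = rim c (Suc i mod n) \<and> up c i \<noteq> up c (Suc i mod n)"
proof -
  consider "i < 2 * c" | "i = 2 * c" | "i = 2 * c + 1" | "i = 2 * c + 2" | "i = 2 * c + 3"
    | "2 * c + 4 \<le> i" "Suc i < n" | "Suc i = n"
    using assms(1) by linarith
  then show ?thesis
  proof cases
    case 1
    then show ?thesis using n by (simp add: rim_def up_def)
  next
    case 2
    then have "Suc i mod n = 2 * c + 1" using n by simp
    then show ?thesis using E(1) 2 by (simp add: rim_def up_def)
  next
    case 3
    then have "Suc i mod n = 2 * c + 2" using n by simp
    then show ?thesis using E(2) 3 by (simp add: rim_def up_def)
  next
    case 4
    then have "Suc i mod n = 2 * c + 3" using n by simp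
    then show ?thesis using E(3) 4 by (simp add: rim_def up_def)
  next
    case 5
    then have "Suc i mod n = 2 * c + 4" using n by simp
    then show ?thesis using E(4) 5 by (simp add: rim_def up_def)
  next
    case 6
    then show ?thesis by (auto simp: rim_def up_def)
  next
    case 7
    then have "i = 2 * (c + d + 2)" using n by simp
    then show ?thesis using E(5) 7 by (simp add: rim_def up_def)
  qed
qed

text \<open>The index range splits into $2c+1$ edges over $0$, three edges over $1, 2, 3$, and
  $2d+1$ edges over $4$. The complementary pairs in the two long blocks contribute $c$ and
  $d$.\<close>

lemma sum_rim_up:
  fixes x :: "nat \<Rightarrow> real"
  shows "(\<Sum>i<2 * c + 2 * d + 5. if up c i then x (rim c i) else 1 - x (rim c i))
         = (\<Sum>i<5. x i) + c + d" (is "sum ?y _ = _")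
proof -
  have "sum ?y {..<2 * c + 1} = (\<Sum>j<2 * c + 1. if even j then x 0 else 1 - x 0)"
    by (intro sum.cong) (auto simp: rim_def up_def)
  also have "\<dots> = x 0 + c" by (rule sum_alternating)
  finally have 1: "sum ?y {..<2 * c + 1} = x 0 + c" .
  have "(\<Sum>j<2 * d + 1. ?y (j + (2 * c + 4))) = (\<Sum>j<2 * d + 1. if even j then x 4 else 1 - x 4)"
    by (intro sum.cong) (auto simp: rim_def up_def)
  also have "\<dots> = x 4 + d" by (rule sum_alternating)
  finally have 2: "(\<Sum>j<2 * d + 1. ?y (j + (2 * c + 4))) = x 4 + d" .
  have "sum ?y {..<2 * c + 2 * d + 5} = sum ?y {..<2 * c + 4} + sum ?y {2 * c + 4..<2 * c + 2 * d + 5}"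
    by (simp add: lessThan_atLeast0 sum.atLeastLessThan_concat)
  also have "sum ?y {2 * c + 4..<2 * c + 2 * d + 5} = (\<Sum>j<2 * d + 1. ?y (j + (2 * c + 4)))"
    using sum.shift_bounds_nat_ivl[of ?y 0 "2 * c + 4" "2 * d + 1"]
    by (simp add: lessThan_atLeast0 algebra_simps)
  also have "{..<2 * c + 4} = insert (2 * c + 3) (insert (2 * c + 2) (insert (2 * c + 1) {..<2 * c + 1}))"
    by auto
  also have "sum ?y \<dots> = sum ?y {..<2 * c + 1} + x 1 + x 2 + x 3"
    by (simp add: rim_def up_def)
  finally show ?thesis unfolding 1 2 by (simp add: eval_nat_numeral)
qed

section \<open>Violating the rank inequality on an odd cycle with an odd ear\<close>

text \<open>The ear, attached at \<open>v 0\<close> and \<open>v b\<close>, is a subdivision of the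
  additional edge $5$. The assumptions \<open>apex\<close> make $5$ adjacent to the images of the
  cycle edges at these two nodes, namely those with indices $0$, $n-1$, $b-1$ and $b$.\<close>

lemma odd_cycle_plus_ear_imperfect_aux:
  fixes H :: "('v, 'e::finite) multigraph" and u :: "nat \<Rightarrow> 'a::real_vector"
  assumes v: "inj_on v {..<n}"
    and e: "bij_betw e {..<n} C" "\<And>i. i < n \<Longrightarrow> ends H (e i) = {v i, v (Suc i mod n)}"
    and p: "inj_on p {..l}" "{p 0, p l} = {v 0, v b}"
      "\<And>j. 0 < j \<Longrightarrow> j < l \<Longrightarrow> p j \<notin> v ` {..<n}"
    and q: "bij_betw q {..<l} (- C)" "\<And>j. j < l \<Longrightarrow> ends H (q j) = {p j, p (Suc j)}"
    and n: "n = 2 * c + 2 * d + 5" and l: "l = 2 * m + 1" and b: "0 < b" "b < n"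
    and rep: "N_plus_repr B u0 u E"
    and cyc: "{0, 1} \<in> E" "{1, 2} \<in> E" "{2, 3} \<in> E" "{3, 4} \<in> E" "{4, 0} \<in> E"
    and apex: "{5, 0} \<in> E" "{5, 4} \<in> E"
      "\<And>i. i = b \<or> Suc i = b \<Longrightarrow> up c i \<and> {5, rim c i} \<in> E"
    and sum: "2 < (\<Sum>i<6. B u0 (u i))"
  shows "N_plus_imperfect (line_graph H)"
proof
  assume perfect: "N_plus_perfect (line_graph H)"
  define ie where "ie = inv_into {..<n} e"
  define iq where "iq = inv_into {..<l} q"
  define g where "g f = (if f \<in> C then rim c (ie f) else 5)" for f
  \<comment> \<open>On the ear the orientation follows parity; since \<open>l\<close> is odd, the
    first and the last ear edge both carry the vector \<open>u 5\<close> itself.\<close>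
  define s where "s f = (if f \<in> C then up c (ie f) else even (iq f))" for f
  have eC: "e i \<in> C" "ie (e i) = i" if "i < n" for i
    using e(1) that by (auto simp: ie_def bij_betw_def)
  have qC: "q j \<notin> C" "iq (q j) = j" if "j < l" for j
    using q(1) that by (auto simp: iq_def bij_betw_def)
  have edge_cases: "(\<exists>i<n. f = e i) \<or> (\<exists>j<l. f = q j)" for f
    using bij_betw_imp_surj_on[OF e(1)] bij_betw_imp_surj_on[OF q(1)] by blast
  have v_eq: "v i = v j \<longleftrightarrow> i = j" if "i < n" "j < n" for i j
    using v that by (auto simp: inj_on_eq_iff)
  have p_eq: "p i = p j \<longleftrightarrow> i = j" if "i \<le> l" "j \<le> l" for i j
    using p(1) that by (auto simp: inj_on_eq_iff)
  have Suc_less: "Suc i mod n < n" for i using n by simp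

  let ?compat = "\<lambda>f h. s f \<and> s h \<and> {g f, g h} \<in> E \<or> g f = g h \<and> s f \<noteq> s h"
  have compat_sym: "?compat h f" if "?compat f h" for f h
    using that by (auto simp: insert_commute)

  have cc: "?compat (e i) (e i')" if "i < n" "i' = Suc i mod n" for i i'
    using rim_up_Suc_mod[OF that(1) n cyc] that eC[of i] eC[of i'] Suc_less[of i]
    by (simp add: g_def s_def)
  have pp: "?compat (q j) (q (Suc j))" if "Suc j < l" for j
    using that by (simp add: g_def s_def qC)
  \<comment> \<open>Inner nodes of the ear lie off the cycle, so the two edges can only meet at a
    foot of the ear. The ear edge is then the first or the last one, of even index, and the cycle
    edge is one of the four covered by \<open>apex\<close>.\<close>
  have pc: "?compat (q j) (e i)" if ji: "j < l" "i < n" "x \<in> ends H (q j)" "x \<in> ends H (e i)" for i j x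
  proof -
    have "x \<in> v ` {..<n}" using ji e(2) Suc_less by auto
    moreover have "x = p j \<or> x = p (Suc j)" using ji q(2) by auto
    ultimately have j: "j = 0 \<and> x = p 0 \<or> Suc j = l \<and> x = p l"
      using p(3)[of j] p(3)[of "Suc j"] ji(1) by (metis Suc_lessI neq0_conv zero_less_Suc)
    then have "even j" using l by auto
    have "x = v 0 \<or> x = v b" using j p(2) by auto
    moreover have "x = v i \<or> x = v (Suc i mod n)" using ji e(2) by auto
    ultimately have "i = 0 \<or> Suc i mod n = 0 \<or> i = b \<or> Suc i mod n = b"
      using v_eq ji(2) b Suc_less by (metis bot_nat_0.not_eq_extremum less_trans)
    then consider "i = 0" | "Suc i = n" | "i = b" | "Suc i = b"
      using ji(2) b by (auto simp: mod_Suc split: if_splits)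
    then have "up c i \<and> {5, rim c i} \<in> E"
    proof cases
      case 2
      then have "i = 2 * (c + d + 2)" using n by simp
      then show ?thesis using apex(2) by (simp add: rim_def up_def)
    qed (use apex in \<open>auto simp: rim_def up_def\<close>)
    then show ?thesis using \<open>even j\<close> ji(1,2) by (simp add: g_def s_def eC qC)
  qed

  have compat: "?compat f h" if fh_adj: "{f, h} \<in> line_graph H" for f h
  proof -
    obtain x where fh: "f \<noteq> h" and x: "x \<in> ends H f" "x \<in> ends H h"
      using fh_adj by (auto simp: line_graph_def doubleton_eq_iff)
    consider i i' where "i < n" "f = e i" "i' < n" "h = e i'"
      | i j where "i < n" "f = e i" "j < l" "h = q j"
      | i j where "i < n" "h = e i" "j < l" "f = q j"
      | j j' where "j < l" "f = q j" "j' < l" "h = q j'"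
      using edge_cases[of f] edge_cases[of h] by blast
    then show ?thesis
    proof cases
      case 1
      have "i = i' \<or> i = Suc i' mod n \<or> Suc i mod n = i' \<or> Suc i mod n = Suc i' mod n"
        using 1 x e(2) v_eq Suc_less by auto
      moreover have "i = i'" if "Suc i mod n = Suc i' mod n"
        using that 1 by (auto simp: mod_Suc split: if_splits)
      ultimately have "i = Suc i' mod n \<or> i' = Suc i mod n" using 1 fh by auto
      then show ?thesis using cc[of i i'] cc[of i' i] compat_sym 1 by blast
    next
      case 2
      then show ?thesis using pc[of j i x] compat_sym x by blast
    next
      case 3
      then show ?thesis using pc[of j i x] x by blast
    next
      case 4
      have "j = j' \<or> j = Suc j' \<or> Suc j = j'"
        using 4 x q(2) p_eq by auto
      then show ?thesis using pp[of j] pp[of j'] compat_sym 4 fh by blast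
    qed
  qed

  define y where "y f = B u0 (if s f then u (g f) else u0 - u (g f))" for f
  have y_eq: "y f = (if s f then B u0 (u (g f)) else 1 - B u0 (u (g f)))" for f
    using rep by (simp add: y_def N_plus_repr_def psd_form_def bilinear_rsub)
  have "N_plus_repr B u0 (\<lambda>f. if s f then u (g f) else u0 - u (g f)) (line_graph H)"
    using rep compat by (rule N_plus_repr_lift)
  then have "(\<chi> f. y f) \<in> STAB (line_graph H)"
    using N_plus_repr_in_N_plus perfect unfolding y_def N_plus_perfect_def by blast
  moreover have "real (card S) \<le> real (c + d + m + 2)" if "stable (line_graph H) S" for S
  proof -
    define N where "N = v ` {..<n} \<union> p ` {0<..<l}"
    have "v 0 \<in> N" "v b \<in> N" using b by (auto simp: N_def)
    then have pN: "p j \<in> N" if "j \<le> l" for j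
      using that p(2) by (cases "j = 0 \<or> j = l") (auto simp: N_def doubleton_eq_iff)
    have "ends H f \<subseteq> N \<and> card (ends H f) = 2" for f
    proof -
      have Suc_mod_neq: "Suc i mod n \<noteq> i" if "i < n" for i
        using that n by (auto simp: mod_Suc)
      have "\<exists>x y. ends H f = {x, y} \<and> x \<in> N \<and> y \<in> N \<and> x \<noteq> y"
        using edge_cases[of f]
      proof (elim disjE exE conjE)
        fix i assume "i < n" "f = e i"
        then show ?thesis
          using e(2) v_eq[of i "Suc i mod n"] Suc_less[of i] Suc_mod_neq[of i]
          by (intro exI[of _ "v i"] exI[of _ "v (Suc i mod n)"]) (auto simp: N_def)
      next
        fix j assume "j < l" "f = q j"
        then show ?thesis
          using q(2) pN p_eq[of j "Suc j"] by (intro exI[of _ "p j"] exI[of _ "p (Suc j)"]) simp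
      qed
      then show ?thesis by auto
    qed
    then have "2 * card S \<le> card N"
      using that by (intro stable_line_graph_card_le) (auto simp: N_def)
    also have "card N \<le> n + (l - 1)"
      unfolding N_def
      by (rule order_trans[OF card_Un_le add_mono]) (auto intro: order_trans[OF card_image_le])
    \<comment> \<open>The bound on the number of nodes is odd, so halving it rounds down; this is
      where the rank inequality becomes stronger than the sum of the degree constraints.\<close>
    finally have "2 * card S \<le> 2 * (c + d + m + 2) + 1" using n l by simp
    then have "card S \<le> c + d + m + 2" by arith
    then show ?thesis by simp
  qed
  \<comment> \<open>The subdivisions add $c + d + m$ to the sum as well as to the bound, so a sum
    greater than $2$ over the six original nodes gives the contradiction.\<close>
  ultimately have "(\<Sum>f\<in>UNIV. y f) \<le> c + d + m + 2"
    using STAB_sum_le[of "\<chi> f. y f"] by fastforce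
  moreover have "(\<Sum>f\<in>UNIV. y f) = (\<Sum>f\<in>C. y f) + (\<Sum>f\<in>- C. y f)"
    by (metis Compl_disjoint Compl_partition finite sum.union_disjoint)
  moreover have "(\<Sum>f\<in>C. y f) = (\<Sum>i<n. y (e i))"
    by (simp add: sum.reindex_bij_betw[OF e(1)])
  moreover have "\<dots> = (\<Sum>i<5. B u0 (u i)) + c + d"
    unfolding sum_rim_up[of c "\<lambda>i. B u0 (u i)" d, symmetric] n[symmetric]
    by (intro sum.cong) (simp_all add: y_eq g_def s_def eC)
  moreover have "(\<Sum>f\<in>- C. y f) = (\<Sum>j<l. y (q j))"
    by (simp add: sum.reindex_bij_betw[OF q(1)])
  moreover have "\<dots> = B u0 (u 5) + m"
    unfolding sum_alternating[where a = "B u0 (u 5)" and m = m, symmetric] l[symmetric]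
    by (intro sum.cong) (simp_all add: y_eq g_def s_def qC)
  ultimately show False using sum by (simp add: eval_nat_numeral)
qed


section \<open>Explicit representations on six nodes\<close>

text \<open>Reduces a representation to finitely many numerical checks. The nodes have type
  \<open>nat\<close>, so \<open>min i 5\<close> repeats the last vector beyond index $5$; every
  \<open>u i\<close> is then in the list, and the edges only use indices below $6$.\<close>

lemma N_plus_repr_listI:
  fixes us :: "'a::real_vector list"
  assumes "psd_form B" "B u0 u0 = 1" and len: "length us = 6"
    and es: "\<forall>(j, k) \<in> set es. j < 6 \<and> k < 6"
    and us: "\<forall>x\<in>set us. B x (u0 - x) = 0 \<and> (\<forall>v\<in>{x, u0 - x}. 0 < B v u0 \<and>
      (\<forall>y\<in>set us. 0 \<le> B v y \<and> B v y \<le> B v u0) \<and>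
      (\<forall>(j, k)\<in>set es. B v (us ! j) + B v (us ! k) \<le> B v u0))"
  shows "N_plus_repr B u0 (\<lambda>i. us ! min i 5) ((\<lambda>(j, k). {j, k}) ` set es)"
proof -
  have mem: "us ! min i 5 \<in> set us" for i using len by simp
  have "column_ok B u0 (\<lambda>i. us ! min i 5) ((\<lambda>(j, k). {j, k}) ` set es) v"
    if "x \<in> set us" "v \<in> {x, u0 - x}" for x v
  proof -
    have "B v (us ! min j 5) + B v (us ! min k 5) \<le> B v u0"
      if "{j, k} = {j', k'}" "(j', k') \<in> set es" for j k j' k'
    proof -
      have "B v (us ! j') + B v (us ! k') \<le> B v u0"
        using us \<open>x \<in> set us\<close> \<open>v \<in> {x, u0 - x}\<close> that(2) by blast
      moreover have "j' < 6" "k' < 6" using es that(2) by auto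
      ultimately show ?thesis
        using that(1) by (auto simp: doubleton_eq_iff min_def)
    qed
    then show ?thesis using us that mem unfolding column_ok_def by fastforce
  qed
  then show ?thesis using assms(1,2) us mem unfolding N_plus_repr_def by blast
qed

type_synonym real6 = "real \<times> real \<times> real \<times> real \<times> real \<times> real"

fun diag_form :: "real6 \<Rightarrow> real6 \<Rightarrow> real6 \<Rightarrow> real" where
  "diag_form (w1, w2, w3, w4, w5, w6) (x1, x2, x3, x4, x5, x6) (y1, y2, y3, y4, y5, y6) =
    w1 * x1 * y1 + w2 * x2 * y2 + w3 * x3 * y3 + w4 * x4 * y4 + w5 * x5 * y5 + w6 * x6 * y6"

lemma psd_form_diag_form:
  assumes "0 \<le> w1" "0 \<le> w2" "0 \<le> w3" "0 \<le> w4" "0 \<le> w5" "0 \<le> w6"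
  shows "psd_form (diag_form (w1, w2, w3, w4, w5, w6))"
proof -
  let ?B = "diag_form (w1, w2, w3, w4, w5, w6)"
  have "bilinear ?B"
    unfolding bilinear_def linear_iff by (auto simp: algebra_simps)
  moreover have "?B x y = ?B y x" for x y
    by (cases x; cases y) (simp add: mult_ac)
  moreover have "0 \<le> ?B x x" for x
    using assms by (cases x) (simp add: mult.assoc)
  ultimately show ?thesis by (simp add: psd_form_def)
qed

text \<open>
  The nodes $0, \dots, 4$ of the two graphs below are the edges of a 5-cycle and $5$ is the
  additional edge. The vectors are the columns of $L$ in a decomposition $Y = L^T D L$ of a matrix
  $Y$ with rational entries found numerically.
\<close>

definition chord_edges :: "(nat \<times> nat) list" where
  "chord_edges = [(0, 1), (1, 2), (2, 3), (3, 4), (4, 0), (5, 0), (5, 2), (5, 3), (5, 4)]"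

definition chord_vectors :: "real6 list" where
  "chord_vectors = [(2, 0, 0, 0, 0, 0), (0, 1, -1, 3, 1, 3), (1, 1, 2, 0, 0, 0),
    (1, 0, -1, 5, 0, 0), (0, 2, 0, 0, 0, 0), (0, 0, 0, 0, 1, 0)]"

definition parallel_edges :: "(nat \<times> nat) list" where
  "parallel_edges = [(0, 1), (1, 2), (2, 3), (3, 4), (4, 0), (5, 0), (5, 1), (5, 4)]"

definition parallel_vectors :: "real6 list" where
  "parallel_vectors = [(2, 0, 0, 0, 0, 0), (0, 2, 0, 0, 0, 0), (1, 0, 2, 1, 2, 0),
    (1, 1, -1, 1, 1, 3), (0, 1, 3, 0, 0, 0), (0, 0, 0, 2, 0, 0)]"

text \<open>The denominator $304$ normalises \<open>B u0 u0\<close> to $1$. The point represented is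
  $(120, 120, 120, 120, 120, 12)/304$, with sum $612/304 > 2$.\<close>

lemma N_plus_repr_chord:
  "N_plus_repr (diag_form (30/304, 30/304, 15/304, 3/304, 12/304, 4/304)) (2, 2, 0, 4, 1, 1)
    (\<lambda>i. chord_vectors ! min i 5) ((\<lambda>(j, k). {j, k}) ` set chord_edges)"
  by (intro N_plus_repr_listI psd_form_diag_form)
    (simp_all add: chord_vectors_def chord_edges_def)

text \<open>Here the denominator is $124$ and the point is $(12, 72, 42, 42, 72, 12)/124$, with sum
  $252/124 > 2$.\<close>

lemma N_plus_repr_parallel:
  "N_plus_repr (diag_form (3/124, 18/124, 6/124, 3/124, 3/124, 1/124)) (2, 2, 2, 2, 1, 1)
    (\<lambda>i. parallel_vectors ! min i 5) ((\<lambda>(j, k). {j, k}) ` set parallel_edges)"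
  by (intro N_plus_repr_listI psd_form_diag_form)
    (simp_all add: parallel_vectors_def parallel_edges_def)

section \<open>Numbering the cycle from a foot of the ear\<close>

lemma bij_betw_rotate:
  fixes n i :: nat
  assumes "0 < n"
  shows "bij_betw (\<lambda>t. (t + i) mod n) {..<n} {..<n}"
proof -
  have "inj_on (\<lambda>t. (t + i) mod n) {..<n}"
  proof (rule inj_onI)
    fix s t assume "s \<in> {..<n}" "t \<in> {..<n}" and "(s + i) mod n = (t + i) mod n"
    then have "s mod n = t mod n"
      unfolding cong_def[symmetric] by (simp only: cong_add_rcancel_nat)
    then show "s = t" using \<open>s \<in> {..<n}\<close> \<open>t \<in> {..<n}\<close> by simp
  qed
  moreover have "(\<lambda>t. (t + i) mod n) ` {..<n} \<subseteq> {..<n}" using assms by auto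
  ultimately show ?thesis by (simp add: bij_betw_def endo_inj_surj)
qed

lemma is_cycle_odd_arc:
  assumes cyc: "is_cycle H n W C" and "odd n" and xy: "x \<in> W" "y \<in> W" "x \<noteq> y"
  obtains v e b where "bij_betw v {..<n} W" "bij_betw e {..<n} C"
    "\<forall>i<n. ends H (e i) = {v i, v (Suc i mod n)}"
    "odd b" "b < n" "{x, y} = {v 0, v b}"
proof -
  obtain v e where v: "bij_betw v {..<n} W" and e: "bij_betw e {..<n} C"
    and ends: "\<And>i. i < n \<Longrightarrow> ends H (e i) = {v i, v (Suc i mod n)}" and "0 < n"
    using cyc by (auto simp: is_cycle_def)
  have "\<exists>i j. i < j \<and> j < n \<and> {x, y} = {v i, v j}"
  proof -
    obtain i j where "i < n" "j < n" "x = v i" "y = v j"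
      using v xy by (auto simp: bij_betw_def)
    then show ?thesis using xy(3) by (cases i j rule: linorder_cases) auto
  qed
  then obtain i j where ij: "i < j" "j < n" "{x, y} = {v i, v j}" by blast
  \<comment> \<open>If the arc from \<open>i\<close> to \<open>j\<close> is even, the odd one starts
    at \<open>j\<close> and returns to \<open>i\<close> through the end of the numbering.\<close>
  define s where "s = (if odd (j - i) then i else j)"
  define b where "b = (if odd (j - i) then j - i else n - (j - i))"
  let ?r = "\<lambda>t. (t + s) mod n"
  have r: "bij_betw ?r {..<n} {..<n}" using bij_betw_rotate[OF \<open>0 < n\<close>] .
  show thesis
  proof (rule that[of "v \<circ> ?r" "e \<circ> ?r" b])
    show "bij_betw (v \<circ> ?r) {..<n} W" "bij_betw (e \<circ> ?r) {..<n} C"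
      using bij_betw_trans[OF r v] bij_betw_trans[OF r e] .
    show "\<forall>i<n. ends H ((e \<circ> ?r) i) = {(v \<circ> ?r) i, (v \<circ> ?r) (Suc i mod n)}"
      using ends[of "?r _"] \<open>0 < n\<close> by (simp add: mod_simps)
    show "odd b" "b < n" using ij \<open>odd n\<close> by (auto simp: b_def)
    show "{x, y} = {(v \<circ> ?r) 0, (v \<circ> ?r) b}"
      using ij by (auto simp: s_def b_def insert_commute)
  qed
qed

lemma odd_cycle_plus_ear_imperfect:
  fixes H :: "('v, 'e::finite) multigraph"
  assumes k: "k \<ge> 2" and cyc: "is_cycle H (2 * k + 1) W C"
    and "odd l" and path: "is_path H l p (- C)"
    and pW: "p 0 \<in> W" "p l \<in> W" "p ` {0<..<l} \<inter> W = {}"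
  shows "N_plus_imperfect (line_graph H)"
proof -
  obtain m where l: "l = 2 * m + 1" using \<open>odd l\<close> by (elim oddE)
  obtain q where p: "inj_on p {..l}" and q: "bij_betw q {..<l} (- C)"
    and ends_q: "\<And>j. j < l \<Longrightarrow> ends H (q j) = {p j, p (Suc j)}"
    using path by (auto simp: is_path_def)
  have "odd (2 * k + 1)" by simp
  moreover have "p 0 \<noteq> p l" using p l by (auto simp: inj_on_eq_iff)
  ultimately obtain v e b where v: "bij_betw v {..<2 * k + 1} W" and e: "bij_betw e {..<2 * k + 1} C"
    and ends_e: "\<forall>i<2 * k + 1. ends H (e i) = {v i, v (Suc i mod (2 * k + 1))}"
    and b: "odd b" "b < 2 * k + 1" "{p 0, p l} = {v 0, v b}"
    by (rule is_cycle_odd_arc[OF cyc _ pW(1,2)])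
  have inner: "p j \<notin> v ` {..<2 * k + 1}" if "0 < j" "j < l" for j
  proof -
    have "p j \<in> p ` {0<..<l}" using that by simp
    then show ?thesis using pW(3) bij_betw_imp_surj_on[OF v] by blast
  qed
  have imperfect: "N_plus_imperfect (line_graph H)"
    if "2 * k + 1 = 2 * c + 2 * d + 5" "N_plus_repr B u0 u E"
      "{0, 1} \<in> E" "{1, 2} \<in> E" "{2, 3} \<in> E" "{3, 4} \<in> E" "{4, 0} \<in> E" "{5, 0} \<in> E" "{5, 4} \<in> E"
      "\<And>i. i = b \<or> Suc i = b \<Longrightarrow> up c i \<and> {5, rim c i} \<in> E"
      "2 < (\<Sum>i<6. B u0 (u i))"
    for c d :: nat and B :: "real6 \<Rightarrow> real6 \<Rightarrow> real" and u0 u E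
    by (rule odd_cycle_plus_ear_imperfect_aux[where v = v and e = e and p = p and q = q and b = b
        and n = "2 * k + 1" and l = l and C = C and c = c and d = d and m = m and B = B and ?u0.0 = u0
        and u = u and E = E, OF bij_betw_imp_inj_on[OF v] e ends_e[rule_format] p b(3) inner q ends_q that(1) l
        odd_pos[OF b(1)] b(2) that(2-)])
  have lessThan_6: "{..<6::nat} = {0, 1, 2, 3, 4, 5}" by auto
  show ?thesis
  \<comment> \<open>If \<open>b = 1\<close>, the ear subdivides an edge parallel to edge $0$ of the
    5-cycle, and only edge $4$ is subdivided on the cycle. Otherwise $b = 2c + 3$: the odd arc
    subdivides the path $0, 1, 2$, the even arc the path $3, 4$, and the ear a chord between their
    common ends.\<close>
  proof (cases "b = 1")
    case True
    show ?thesis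
    proof (rule imperfect[of 0 "k - 2", OF _ N_plus_repr_parallel])
      show "2 * k + 1 = 2 * 0 + 2 * (k - 2) + 5" using k by simp
      show "up 0 i \<and> {5, rim 0 i} \<in> (\<lambda>(j, k). {j, k}) ` set parallel_edges"
        if "i = b \<or> Suc i = b" for i
      proof -
        have "i = 0 \<or> i = 1" using that True by linarith
        then show ?thesis by (elim disjE) (simp_all add: up_def rim_def parallel_edges_def)
      qed
    qed (simp_all add: parallel_edges_def parallel_vectors_def lessThan_6)
  next
    case False
    have "b = 2 * ((b - 3) div 2) + 3" using False b(1) by presburger
    then obtain c where c: "b = 2 * c + 3" by blast
    show ?thesis
    proof (rule imperfect[of c "k - c - 2", OF _ N_plus_repr_chord])
      show "2 * k + 1 = 2 * c + 2 * (k - c - 2) + 5" using b(2) c by simp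
      show "up c i \<and> {5, rim c i} \<in> (\<lambda>(j, k). {j, k}) ` set chord_edges"
        if "i = b \<or> Suc i = b" for i
      proof -
        have "i = 2 * c + 3 \<or> i = 2 * c + 2" using that c by linarith
        then show ?thesis by (elim disjE) (simp_all add: up_def rim_def chord_edges_def)
      qed
    qed (simp_all add: chord_edges_def chord_vectors_def lessThan_6)
  qed
qed

section \<open>Reduction of the three cases to an odd ear\<close>

theorem theorem1:
  fixes H :: "('v, 'e::finite) multigraph" and k :: nat
  assumes "k \<ge> 2"
    and "cycle_plus_parallel_edge (2 * k + 1) H \<or>
         cycle_plus_chord (2 * k + 1) H \<or>
         cycle_plus_odd_path (2 * k + 1) H"
  shows "N_plus_imperfect (line_graph H)"
proof -
  \<comment> \<open>A parallel edge and a chord are both ears of length one.\<close>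
  have single: "N_plus_imperfect (line_graph H)"
    if "is_cycle H (2 * k + 1) W (- {f})" "x \<in> W" "y \<in> W" "x \<noteq> y" "ends H f = {x, y}" for W f x y
  proof -
    let ?p = "\<lambda>i::nat. if i = 0 then x else y"
    have "is_path H 1 ?p (- (- {f}))"
      using that by (auto simp: is_path_def inj_on_def bij_betw_def le_Suc_eq intro!: exI[of _ "\<lambda>_. f"])
    moreover have "?p 0 \<in> W" "?p 1 \<in> W" "?p ` {0<..<1} \<inter> W = {}"
      using that by auto
    ultimately show ?thesis
      using odd_cycle_plus_ear_imperfect[OF assms(1) that(1) odd_one] by blast
  qed
  from assms(2) consider "cycle_plus_parallel_edge (2 * k + 1) H"
    | "cycle_plus_chord (2 * k + 1) H" | "cycle_plus_odd_path (2 * k + 1) H"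
    by blast
  then show ?thesis
  proof cases
    case 1
    then obtain f e where cyc: "is_cycle H (2 * k + 1) (nodes H) (- {f})"
      and e: "e \<in> - {f}" "ends H f = ends H e"
      by (auto simp: cycle_plus_parallel_edge_def)
    obtain v c where v: "bij_betw v {..<2 * k + 1} (nodes H)"
      and c: "bij_betw c {..<2 * k + 1} (- {f})"
      and ends: "\<And>i. i < 2 * k + 1 \<Longrightarrow> ends H (c i) = {v i, v (Suc i mod (2 * k + 1))}"
      using cyc by (auto simp: is_cycle_def)
    obtain i where i: "i < 2 * k + 1" "e = c i"
      using c e(1) by (auto simp: bij_betw_def)
    have "Suc i mod (2 * k + 1) \<noteq> i" "Suc i mod (2 * k + 1) < 2 * k + 1"
      using i assms(1) by (auto simp: mod_Suc)
    then have "v i \<noteq> v (Suc i mod (2 * k + 1))" "v i \<in> nodes H" "v (Suc i mod (2 * k + 1)) \<in> nodes H"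
      using v i(1) by (auto simp: bij_betw_def inj_on_eq_iff)
    then show ?thesis using single[OF cyc] e(2) ends[OF i(1)] i(2) by simp
  next
    case 2
    then obtain f x y where "is_cycle H (2 * k + 1) (nodes H) (- {f})" "x \<in> nodes H" "y \<in> nodes H"
      "x \<noteq> y" "ends H f = {x, y}"
      unfolding cycle_plus_chord_def nonadjacent_in_def by blast
    then show ?thesis by (rule single)
  next
    case 3
    then show ?thesis
      using odd_cycle_plus_ear_imperfect[OF assms(1)] unfolding cycle_plus_odd_path_def by blast
  qed
qed

end
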